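(* Let ${\cal D}_2$ be the class of all $2$-regular connected graphs $H$ for which there exist a connected graph $G$ and a positive integer $k$ with $H\cong D_k(G)$. Then, up to isomorphism, ${\cal D}_2=\{C_6,C_8\}$.
   Context: Graphs are finite and simple, with nonempty vertex set. $C_m$ denotes the cycle on $m$ vertices. A set $S\subseteq V(G)$ is a dominating set of $G$ if every vertex in $V(G)\setminus S$ is adjacent to at least one vertex of $S$. For a positive integer $k$, the $k$-dominating graph $D_k(G)$ is the graph whose vertices are the dominating sets of $G$ of cardinality at most $k$, two of them being adjacent if and only if one is obtained from the other by adding or deleting a single vertex. $\cong$ denotes graph isomorphism. *)

theory Defs
  imports "Graph_Theory.Graph_Theory"
begin

text \<open>
  Simple graphs are the library's \<^locale>\<open>pair_graph\<close>s: finite, loop-free, symmetric arc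
  relations. An undirected edge is a pair of opposite arcs, so the degree of a vertex is its
  \<^const>\<open>out_degree\<close>. The null graph is a \<^locale>\<open>pair_graph\<close>, but it is excluded by
  \<^const>\<open>connected\<close>.
\<close>

definition graph_iso :: "'a pair_pre_digraph \<Rightarrow> 'b pair_pre_digraph \<Rightarrow> bool" (infix \<open>\<cong>\<^sub>g\<close> 50) where
  "G \<cong>\<^sub>g H \<longleftrightarrow> digraph_iso (with_proj G) (with_proj H)"

definition regular :: "nat \<Rightarrow> 'a pair_pre_digraph \<Rightarrow> bool" where
  "regular d G \<longleftrightarrow> (\<forall>v \<in> pverts G. out_degree (with_proj G) v = d)"

text \<open>Only meant for \<open>m \<ge> 3\<close>.\<close>

definition cycle_graph :: "nat \<Rightarrow> nat pair_pre_digraph" where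
  "cycle_graph m = \<lparr> pverts = {..<m},
     parcs = {(i, j). i < m \<and> j < m \<and> (j = (i + 1) mod m \<or> i = (j + 1) mod m)} \<rparr>"

definition dominating_set :: "'a pair_pre_digraph \<Rightarrow> 'a set \<Rightarrow> bool" where
  "dominating_set G S \<longleftrightarrow>
     S \<subseteq> pverts G \<and> (\<forall>v \<in> pverts G - S. \<exists>u \<in> S. (v, u) \<in> parcs G)"

definition dominating_graph :: "nat \<Rightarrow> 'a pair_pre_digraph \<Rightarrow> 'a set pair_pre_digraph" where
  "dominating_graph k G =
     (let V = {S. dominating_set G S \<and> card S \<le> k} in
      \<lparr> pverts = V,
        parcs = {(S, T). S \<in> V \<and> T \<in> V \<and>
          ((\<exists>v. v \<notin> S \<and> T = insert v S) \<or> (\<exists>v \<in> S. T = S - {v}))} \<rparr>)"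

text \<open>
  The vertices of the witness \<open>G\<close> are natural numbers because a type cannot be quantified over;
  lemma \<open>D2_I\<close> below shows that this is no restriction.
\<close>

definition D2 :: "'a pair_pre_digraph set" where
  "D2 = {H. pair_graph H \<and> regular 2 H \<and> connected (with_proj H) \<and>
     (\<exists>(G :: nat pair_pre_digraph) k. pair_graph G \<and> connected (with_proj G) \<and> k > 0 \<and>
        H \<cong>\<^sub>g dominating_graph k G)}"

definition rename :: "('a \<Rightarrow> 'b) \<Rightarrow> 'a pair_pre_digraph \<Rightarrow> 'b pair_pre_digraph" where
  "rename f G = \<lparr> pverts = f ` pverts G, parcs = map_prod f f ` parcs G \<rparr>"

lemma rename_iso:
  assumes "pair_wf_digraph G" "inj_on f (pverts G)"
  defines "h \<equiv> \<lparr> iso_verts = f, iso_arcs = map_prod f f, iso_head = snd, iso_tail = fst \<rparr>"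
  shows "pre_digraph.digraph_isomorphism (with_proj G) h"
    and "with_proj (rename f G) = app_iso h (with_proj G)"
proof -
  note arcsD = pair_wf_digraph.in_arcsD1[OF assms(1)] pair_wf_digraph.in_arcsD2[OF assms(1)]
  have wf: "wf_digraph (with_proj G)"
    by (rule wf_digraph.intro) (auto intro: arcsD)
  have "inj_on (map_prod f f) (parcs G)"
    by (rule inj_on_subset[OF map_prod_inj_on[OF assms(2) assms(2)]])
      (auto intro: arcsD)
  then show "pre_digraph.digraph_isomorphism (with_proj G) h"
    using assms(2) wf
    by (auto simp: pre_digraph.digraph_isomorphism_def h_def)
  show "with_proj (rename f G) = app_iso h (with_proj G)"
    by (simp add: app_iso_def h_def with_proj_def rename_def)
qed

lemma pair_graph_rename:
  assumes "pair_graph G" "inj_on f (pverts G)"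
  shows "pair_graph (rename f G)"
proof -
  interpret pair_graph G by fact
  show ?thesis
  proof (unfold_locales, goal_cases)
    case (5 e)
    then obtain a b where ab: "(a, b) \<in> parcs G" "e = (f a, f b)" by (auto simp: rename_def)
    have "a \<noteq> b" using pair_no_loops[OF ab(1)] by simp
    then show ?case
      using ab(2) inj_onD[OF assms(2)] in_arcsD1[OF ab(1)] in_arcsD2[OF ab(1)] by auto
  next
    case 6
    show ?case
      using pair_sym_arcs by (force simp: symmetric_def sym_def rename_def)
  qed (auto simp: rename_def pair_finite_verts pair_finite_arcs dest: in_arcsD1 in_arcsD2)
qed

lemma dominating_set_rename:
  assumes "pair_wf_digraph G" "inj_on f (pverts G)" "S \<subseteq> pverts G"
  shows "dominating_set (rename f G) (f ` S) \<longleftrightarrow> dominating_set G S"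
proof -
  note arcsD = pair_wf_digraph.in_arcsD1[OF assms(1)] pair_wf_digraph.in_arcsD2[OF assms(1)]
  have "(f v, f u) \<in> map_prod f f ` parcs G \<longleftrightarrow> (v, u) \<in> parcs G"
    if "v \<in> pverts G" "u \<in> pverts G" for u v
  proof
    assume "(f v, f u) \<in> map_prod f f ` parcs G"
    then obtain a b where ab: "(a, b) \<in> parcs G" "f v = f a" "f u = f b" by auto
    then have "v = a" "u = b"
      using that assms(2) arcsD[OF ab(1)] by (auto dest: inj_onD)
    with ab show "(v, u) \<in> parcs G" by simp
  qed force
  moreover have "f ` pverts G - f ` S = f ` (pverts G - S)"
    using assms(2,3) by (auto simp: inj_on_def)
  ultimately show ?thesis
    using assms(3) unfolding dominating_set_def rename_def by (simp add: image_mono subset_eq)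
qed

lemma dominating_graph_rename:
  assumes "pair_wf_digraph G" "inj_on f (pverts G)"
  shows "dominating_graph k (rename f G) = rename ((`) f) (dominating_graph k G)"
proof -
  define V where "V = {S. dominating_set G S \<and> card S \<le> k}"
  define W where "W = {S. dominating_set (rename f G) S \<and> card S \<le> k}"
  define A where "A S T \<longleftrightarrow> (\<exists>v. v \<notin> S \<and> T = insert v S) \<or> (\<exists>v \<in> S. T = S - {v})"
    for S T :: "'a set"
  define B where "B S T \<longleftrightarrow> (\<exists>v. v \<notin> S \<and> T = insert v S) \<or> (\<exists>v \<in> S. T = S - {v})"
    for S T :: "'b set"
  have sub: "S \<subseteq> pverts G" if "S \<in> V" for S
    using that by (auto simp: V_def dominating_set_def)
  have card: "card (f ` S) = card S" if "S \<subseteq> pverts G" for S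
    using assms(2) that by (meson card_image inj_on_subset)
  have W: "W = (`) f ` V"
  proof (intro set_eqI iffI)
    fix T assume T: "T \<in> W"
    then have "T \<subseteq> f ` pverts G"
      by (auto simp: W_def dominating_set_def rename_def)
    then obtain S where "S \<subseteq> pverts G" "T = f ` S" by (auto simp: subset_image_iff)
    then show "T \<in> (`) f ` V"
      using T card dominating_set_rename[OF assms] by (auto simp: W_def V_def)
  next
    fix T assume "T \<in> (`) f ` V"
    then show "T \<in> W"
      using sub card dominating_set_rename[OF assms] by (auto simp: W_def V_def)
  qed
  have ins: "(\<exists>v. v \<notin> f ` S \<and> f ` T = insert v (f ` S)) \<longleftrightarrow> (\<exists>v. v \<notin> S \<and> T = insert v S)"
    if "S \<subseteq> pverts G" "T \<subseteq> pverts G" for S T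
  proof
    assume "\<exists>v. v \<notin> f ` S \<and> f ` T = insert v (f ` S)"
    then obtain v where v: "v \<notin> f ` S" "f ` T = insert v (f ` S)" by blast
    then obtain u where u: "u \<in> T" "v = f u" by blast
    then have "f ` T = f ` insert u S" using v by simp
    then have "T = insert u S"
      using inj_on_image_eq_iff[OF assms(2), of T "insert u S"] that u by blast
    then show "\<exists>v. v \<notin> S \<and> T = insert v S" using u v by blast
  next
    assume "\<exists>v. v \<notin> S \<and> T = insert v S"
    then obtain v where v: "v \<notin> S" "T = insert v S" by blast
    then have "f v \<notin> f ` S" using that assms(2) by (auto simp: inj_on_def)
    then show "\<exists>v. v \<notin> f ` S \<and> f ` T = insert v (f ` S)" using v by blast
  qed
  have del: "(\<exists>v \<in> S. T = S - {v}) \<longleftrightarrow> (\<exists>v. v \<notin> T \<and> S = insert v T)" for S T :: "'c set"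
    by blast
  have AB: "B (f ` S) (f ` T) \<longleftrightarrow> A S T" if "S \<in> V" "T \<in> V" for S T
    unfolding A_def B_def del using ins[OF sub[OF that(1)] sub[OF that(2)]]
      ins[OF sub[OF that(2)] sub[OF that(1)]] by blast
  have "{(S, T). S \<in> W \<and> T \<in> W \<and> B S T} = map_prod ((`) f) ((`) f) ` {(S, T). S \<in> V \<and> T \<in> V \<and> A S T}"
    unfolding W using AB by (auto simp: image_iff)
  moreover have "dominating_graph k G = \<lparr> pverts = V, parcs = {(S, T). S \<in> V \<and> T \<in> V \<and> A S T} \<rparr>"
    by (simp add: dominating_graph_def V_def A_def Let_def)
  moreover have "dominating_graph k (rename f G) =
      \<lparr> pverts = W, parcs = {(S, T). S \<in> W \<and> T \<in> W \<and> B S T} \<rparr>"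
    by (simp add: dominating_graph_def W_def B_def Let_def)
  ultimately show ?thesis by (simp add: rename_def W)
qed

lemma D2_I:
  fixes H :: "'a pair_pre_digraph" and G :: "'b pair_pre_digraph"
  assumes "pair_graph H" "regular 2 H" "connected (with_proj H)"
    and G: "pair_graph G" "connected (with_proj G)" and "k > 0"
    and iso: "H \<cong>\<^sub>g dominating_graph k G"
  shows "H \<in> D2"
proof -
  have fin: "finite (pverts G)" and wf: "pair_wf_digraph G"
    using G(1) unfolding pair_graph_def pair_digraph_def pair_fin_digraph_def
      pair_fin_digraph_axioms_def by blast+
  obtain f :: "'b \<Rightarrow> nat" where f: "inj_on f (pverts G)"
    using finite_imp_inj_to_nat_seg[OF fin] by blast
  have wfd: "wf_digraph (with_proj G)"
    using rename_iso(1)[OF wf f] by (simp add: pre_digraph.digraph_isomorphism_def)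
  have "connected (with_proj (rename f G))"
    using wf_digraph.connectedI_app_iso[OF wfd G(2) rename_iso(1)[OF wf f]] rename_iso(2)[OF wf f] by simp
  moreover have "H \<cong>\<^sub>g dominating_graph k (rename f G)"
  proof -
    have wf': "pair_wf_digraph (dominating_graph k G)"
      unfolding dominating_graph_def Let_def
      by (rule pair_wf_digraph.intro) (simp_all add: case_prod_beta)
    have inj: "inj_on ((`) f) (pverts (dominating_graph k G))"
      by (rule inj_on_subset[OF inj_on_image_Pow[OF f]])
        (auto simp: dominating_graph_def dominating_set_def Let_def)
    have "dominating_graph k G \<cong>\<^sub>g dominating_graph k (rename f G)"
      unfolding graph_iso_def digraph_iso_def dominating_graph_rename[OF wf f]
      by (intro exI conjI) (rule rename_iso[OF wf' inj])+
    with iso show ?thesis unfolding graph_iso_def by (rule digraph_iso_trans)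
  qed
  ultimately show ?thesis
    unfolding D2_def
    by (intro CollectI conjI exI[of _ "rename f G"] exI[of _ k] assms
        pair_graph_rename[OF G(1) f])
qed

end

theory Submission
  imports Defs
begin

text \<open>
  A dominating set \<open>S\<close> with \<open>|S| < k\<close> has all \<open>n - |S|\<close> sets \<open>insert v S\<close> as neighbours in
  \<open>D\<^sub>k(G)\<close>, so in a 2-regular \<open>D\<^sub>k(G)\<close> the dominating sets of minimum size \<open>\<gamma>\<close> satisfy
  \<open>\<gamma> = n - 2 < k\<close>. The full vertex set would have degree \<open>n \<ge> 3\<close>, hence \<open>k = n - 1\<close>. As the
  complement of a minimal dominating set dominates, \<open>n - 2 \<le> 2\<close>. Finally \<open>D\<^sub>k(G)\<close> is regular and
  bipartite with the \<open>n\<close> sets of size \<open>n - 1\<close> as one part, so it is a cycle of length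
  \<open>2 n \<in> {6, 8}\<close>. Both occur: \<open>C\<^sub>6\<close> is \<open>D\<^sub>2(K\<^sub>3)\<close> and \<open>C\<^sub>8\<close> is \<open>D\<^sub>3(P\<^sub>4)\<close>.
\<close>

section \<open>Graph isomorphism and regularity\<close>

lemma pair_graph_imp_wf: "pair_graph G \<Longrightarrow> pair_wf_digraph G"
  by (simp add: pair_graph_def pair_digraph_def pair_fin_digraph_def)

lemma graph_iso_trans: "G \<cong>\<^sub>g H \<Longrightarrow> H \<cong>\<^sub>g K \<Longrightarrow> G \<cong>\<^sub>g K"
  unfolding graph_iso_def by (rule digraph_iso_trans)

lemma graph_iso_sym: "pair_wf_digraph G \<Longrightarrow> G \<cong>\<^sub>g H \<Longrightarrow> H \<cong>\<^sub>g G"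
  unfolding graph_iso_def by (rule digraph_iso_swap) (simp add: wf_digraph_wp_iff)

lemma graph_iso_rename: "pair_wf_digraph G \<Longrightarrow> inj_on f (pverts G) \<Longrightarrow> G \<cong>\<^sub>g rename f G"
  unfolding graph_iso_def digraph_iso_def using rename_iso by blast

text \<open>Arcs are pairs of vertices, so a vertex bijection that preserves and reflects adjacency
  also determines the arc map, and renaming along it yields exactly \<open>H\<close>.\<close>

lemma graph_isoI:
  assumes "pair_wf_digraph G" "pair_wf_digraph H" "bij_betw f (pverts G) (pverts H)"
    and arcs: "\<And>u v. u \<in> pverts G \<Longrightarrow> v \<in> pverts G \<Longrightarrow> (u, v) \<in> parcs G \<longleftrightarrow> (f u, f v) \<in> parcs H"
  shows "G \<cong>\<^sub>g H"
proof -
  have inj: "inj_on f (pverts G)" and im: "f ` pverts G = pverts H"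
    using assms(3) by (simp_all add: bij_betw_def)
  have "map_prod f f ` parcs G = parcs H"
  proof (intro set_eqI iffI)
    fix e assume "e \<in> map_prod f f ` parcs G"
    then obtain u v where uv: "(u, v) \<in> parcs G" "e = (f u, f v)" by auto
    then show "e \<in> parcs H"
      using arcs[of u v] pair_wf_digraph.wellformed'[OF assms(1) uv(1)] by blast
  next
    fix e assume e: "e \<in> parcs H"
    have "fst e \<in> f ` pverts G" "snd e \<in> f ` pverts G"
      unfolding im
      using pair_wf_digraph.arc_fst_in_verts[OF assms(2) e] pair_wf_digraph.arc_snd_in_verts[OF assms(2) e]
      by this
    then obtain u v where uv: "u \<in> pverts G" "v \<in> pverts G" "e = (f u, f v)"
      by (metis imageE prod.collapse)
    then have "(u, v) \<in> parcs G" using arcs e by blast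
    then show "e \<in> map_prod f f ` parcs G" using uv(3) by (metis image_eqI map_prod_simp)
  qed
  then have "rename f G = H"
    using im by (simp add: rename_def)
  then show ?thesis
    using graph_iso_rename[OF assms(1) inj] by simp
qed

lemma graph_isoE:
  assumes "G \<cong>\<^sub>g H"
  obtains h where "pre_digraph.digraph_isomorphism (with_proj G) h"
    "with_proj H = app_iso h (with_proj G)"
  using assms unfolding graph_iso_def digraph_iso_def by blast

lemma graph_iso_connected:
  assumes "pair_wf_digraph G" "G \<cong>\<^sub>g H" "connected (with_proj G)"
  shows "connected (with_proj H)"
  using assms by (metis graph_isoE wf_digraph.connectedI_app_iso wf_digraph_wp_iff)

lemma graph_iso_pverts:
  assumes "G \<cong>\<^sub>g H"
  obtains f where "bij_betw f (pverts G) (pverts H)"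
proof -
  obtain h where h: "pre_digraph.digraph_isomorphism (with_proj G) h"
    and H: "with_proj H = app_iso h (with_proj G)"
    using graph_isoE[OF assms] .
  have "pverts H = iso_verts h ` pverts G"
    using arg_cong[OF H, of verts] by simp
  then have "bij_betw (iso_verts h) (pverts G) (pverts H)"
    using pre_digraph.digraph_isomorphism_inj_on_verts[OF h] by (simp add: bij_betw_def)
  then show ?thesis by (rule that)
qed

lemma graph_iso_card: "G \<cong>\<^sub>g H \<Longrightarrow> card (pverts G) = card (pverts H)"
  by (metis graph_iso_pverts bij_betw_same_card)

lemma graph_iso_regular:
  assumes "pair_wf_digraph G" "G \<cong>\<^sub>g H" "regular d G"
  shows "regular d H"
proof -
  obtain h where h: "pre_digraph.digraph_isomorphism (with_proj G) h"
    and H: "with_proj H = app_iso h (with_proj G)"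
    using graph_isoE[OF assms(2)] .
  have "pverts H = iso_verts h ` pverts G"
    using arg_cong[OF H, of verts] by simp
  then show ?thesis
    using assms(3) wf_digraph.out_degree_app_iso_eq[OF _ h] assms(1)
    unfolding regular_def H by (auto simp: wf_digraph_wp_iff)
qed

section \<open>Degrees, connectivity and double counting\<close>

lemma out_degree_with_proj: "out_degree (with_proj G) v = card {w. (v, w) \<in> parcs G}"
proof -
  have "out_arcs (with_proj G) v = Pair v ` {w. (v, w) \<in> parcs G}"
    by (auto simp: out_arcs_def)
  then show ?thesis
    by (simp add: out_degree_def card_image inj_on_def)
qed

text \<open>By symmetry a path from the root \<open>a\<close> can be reversed, so any two vertices
  are joined through \<open>a\<close>.\<close>

lemma connected_rootI:
  assumes "pair_graph G" "a \<in> pverts G" "\<And>v. v \<in> pverts G \<Longrightarrow> (a, v) \<in> (parcs G)\<^sup>*"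
  shows "connected (with_proj G)"
proof (rule wf_digraph.connectedI)
  interpret pair_graph G by fact
  show "wf_digraph (with_proj G)" by unfold_locales
  show "verts (with_proj G) \<noteq> {}" using assms(2) by auto
  fix u v assume "u \<in> verts (with_proj G)" "v \<in> verts (with_proj G)"
  then have "a \<rightarrow>\<^sup>*\<^bsub>with_proj G\<^esub> u" "a \<rightarrow>\<^sup>*\<^bsub>with_proj G\<^esub> v"
    using assms reachable_conv' by simp_all
  then have "u \<rightarrow>\<^sup>*\<^bsub>with_proj G\<^esub> v"
    using symmetric_reachable' reachable_trans by blast
  then show "u \<rightarrow>\<^sup>*\<^bsub>with_proj (mk_symmetric (with_proj G))\<^esub> v"
    using reachable_mk_symmetric_eq[OF pair_sym_arcs] by simp
qed

text \<open>A connected symmetric digraph is strongly connected, so a path runs from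
  \<open>a\<close> to every vertex; induction along it never leaves \<open>A\<close>.\<close>

lemma connected_closed_superset:
  assumes "pair_graph G" "connected (with_proj G)" "a \<in> A" "a \<in> pverts G"
    and closed: "\<And>u v. u \<in> A \<Longrightarrow> (u, v) \<in> parcs G \<Longrightarrow> v \<in> A"
  shows "pverts G \<subseteq> A"
proof
  interpret pair_graph G by fact
  fix v assume "v \<in> pverts G"
  have "strongly_connected (with_proj G)"
    by (rule symmetric_connected_imp_strongly_connected) (use pair_sym_arcs assms(2) in auto)
  then have "a \<rightarrow>\<^sup>*\<^bsub>with_proj G\<^esub> v"
    using assms(4) \<open>v \<in> pverts G\<close> by (auto simp: strongly_connected_def)
  then have "(a, v) \<in> (parcs G)\<^sup>*"
    using reachable_rtranclI by force
  then show "v \<in> A"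
    by (induction rule: rtrancl_induct) (use assms(3) closed in auto)
qed

text \<open>An isolated vertex alone would form an arc-closed set and so exhaust the connected
  graph.\<close>

lemma connected_has_neighbour:
  assumes "pair_graph G" "connected (with_proj G)" "card (pverts G) \<ge> 2" "a \<in> pverts G"
  obtains b where "(a, b) \<in> parcs G"
proof -
  have "\<exists>b. (a, b) \<in> parcs G"
  proof (rule ccontr)
    assume "\<nexists>b. (a, b) \<in> parcs G"
    then have "pverts G \<subseteq> {a}"
      using connected_closed_superset[OF assms(1,2), of a "{a}"] assms(4) by blast
    then show False
      using assms(3) card_mono[of "{a}" "pverts G"] by simp
  qed
  then show ?thesis using that by blast
qed

text \<open>Double counting of the arcs from \<open>A\<close> to \<open>B\<close>: each vertex of
  either side meets exactly \<open>d\<close> of them, so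
  \<open>d * card A = d * card B\<close>.\<close>

lemma regular_bipartite_card_eq:
  assumes "pair_graph G" "regular d G" "d > 0" "pverts G = A \<union> B"
    and cross: "\<And>u v. (u, v) \<in> parcs G \<Longrightarrow> u \<in> A \<longleftrightarrow> v \<in> B"
  shows "card A = card B"
proof -
  interpret pair_graph G by fact
  have fin: "finite A" "finite B" using pair_finite_verts assms(4) by auto
  have "card {v. v \<in> B \<and> (u, v) \<in> parcs G} = d" if "u \<in> A" for u
  proof -
    have "{v. v \<in> B \<and> (u, v) \<in> parcs G} = {v. (u, v) \<in> parcs G}"
      using cross that by blast
    then show ?thesis
      using assms(2,4) that by (simp add: regular_def out_degree_with_proj)
  qed
  moreover have "card {u. u \<in> A \<and> (u, v) \<in> parcs G} = d" if "v \<in> B" for v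
  proof -
    have "{u. u \<in> A \<and> (u, v) \<in> parcs G} = {u. (v, u) \<in> parcs G}"
      using cross that arcs_symmetric by blast
    then show ?thesis
      using assms(2,4) that by (simp add: regular_def out_degree_with_proj)
  qed
  ultimately have "(\<Sum>u\<in>A. d) = d * card B"
    using sum_multicount[OF fin, of "\<lambda>u v. (u, v) \<in> parcs G" d] by simp
  then show ?thesis using assms(3) by simp
qed

section \<open>Cycles\<close>

lemma pverts_cycle_graph [simp]: "pverts (cycle_graph m) = {..<m}"
  by (simp add: cycle_graph_def)

lemma parcs_cycle_graph [simp]:
  "(i, j) \<in> parcs (cycle_graph m) \<longleftrightarrow>
     i < m \<and> j < m \<and> (j = (i + 1) mod m \<or> i = (j + 1) mod m)"
  by (simp add: cycle_graph_def)

lemma pair_graph_cycle_graph: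
  assumes "m \<ge> 2"
  shows "pair_graph (cycle_graph m)"
proof
  show "finite (parcs (cycle_graph m))"
    by (rule finite_subset[of _ "{..<m} \<times> {..<m}"]) (auto simp: cycle_graph_def)
next
  show "symmetric (with_proj (cycle_graph m))"
    by (auto simp: symmetric_def sym_def)
next
  fix e assume "e \<in> parcs (cycle_graph m)"
  then show "fst e \<noteq> snd e"
    using assms by (cases e) (auto simp: mod_Suc split: if_splits)
qed (auto simp: cycle_graph_def)

lemma regular_cycle_graph:
  assumes "m \<ge> 3"
  shows "regular 2 (cycle_graph m)"
  unfolding regular_def out_degree_with_proj
proof
  fix i assume "i \<in> pverts (cycle_graph m)"
  then have i: "i < m" by simp
  have "{j. (i, j) \<in> parcs (cycle_graph m)} =
    {if Suc i = m then 0 else Suc i, if i = 0 then m - 1 else i - 1}"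
    using i assms by (auto simp: mod_Suc split: if_splits)
  \<comment> \<open>Here \<open>m \<ge> 3\<close> matters: for \<open>m = 2\<close> successor and
    predecessor coincide.\<close>
  moreover have "(if Suc i = m then 0 else Suc i) \<noteq> (if i = 0 then m - 1 else i - 1)"
    using i assms by auto
  ultimately show "card {j. (i, j) \<in> parcs (cycle_graph m)} = 2" by simp
qed

lemma connected_cycle_graph:
  assumes "m \<ge> 2"
  shows "connected (with_proj (cycle_graph m))"
proof (rule connected_rootI[OF pair_graph_cycle_graph[OF assms], of 0])
  fix i assume "i \<in> pverts (cycle_graph m)"
  then have "i < m" by simp
  then show "(0, i) \<in> (parcs (cycle_graph m))\<^sup>*"
  proof (induction i)
    case (Suc i)
    then have "(i, Suc i) \<in> parcs (cycle_graph m)" by simp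
    then show ?case using Suc by (meson Suc_lessD rtrancl.rtrancl_into_rtrancl)
  qed simp
qed (use assms in simp)

text \<open>Once this is known, identifying a member of \<open>D2\<close> only requires its number
  of vertices.\<close>

lemma connected_regular_2_iso_cycle_graph:
  assumes "pair_graph G" "regular 2 G" "connected (with_proj G)"
  shows "G \<cong>\<^sub>g cycle_graph (card (pverts G))"
proof -
  interpret pair_graph G by fact
  define N where "N v = {w. (v, w) \<in> parcs G}" for v
  have N: "card (N v) = 2" if "v \<in> pverts G" for v
    using assms(2) that by (simp add: regular_def out_degree_with_proj N_def)
  \<comment> \<open>Lets a walk that arrives from \<open>u\<close> leave \<open>v\<close> in another
    direction.\<close>
  have other: "\<exists>w \<in> N v. w \<noteq> u" if "v \<in> pverts G" for u v
  proof (rule ccontr)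
    assume "\<not> (\<exists>w \<in> N v. w \<noteq> u)"
    then have "N v \<subseteq> {u}" by blast
    then show False using N[OF that] card_mono[of "{u}" "N v"] by simp
  qed
  have N_eq: "N v = {u, w}" if "u \<in> N v" "w \<in> N v" "u \<noteq> w" "v \<in> pverts G" for u v w
  proof -
    have "finite (N v)" using N[OF that(4)] card.infinite by fastforce
    then show ?thesis
      using that N[OF that(4)] card_subset_eq[of "N v" "{u, w}"] by simp
  qed
  obtain a where a: "a \<in> pverts G"
    using assms(3) by (auto simp: connected_conv)
  \<comment> \<open>Walk without ever turning back, recording arcs. As every vertex has only two neighbours, the
    first repeated vertex is the starting point; the cycle it closes is a whole component.\<close>
  obtain p where p: "\<And>n. p n \<in> parcs G"
    "\<And>n. fst (p (Suc n)) = snd (p n) \<and> snd (p (Suc n)) \<noteq> fst (p n)"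
  proof -
    have "\<exists>x. x \<in> parcs G" using other[OF a, of a] by (auto simp: N_def)
    moreover have "\<exists>y. y \<in> parcs G \<and> fst y = snd x \<and> snd y \<noteq> fst x" if "x \<in> parcs G" for x
      using other[of "snd x" "fst x"] arc_snd_in_verts[OF that] by (force simp: N_def)
    ultimately show ?thesis
      using dependent_nat_choice[of "\<lambda>_ x. x \<in> parcs G"
          "\<lambda>_ x y. fst y = snd x \<and> snd y \<noteq> fst x"] that by metis
  qed
  define f where "f n = fst (p n)" for n
  have arc: "(f n, f (Suc n)) \<in> parcs G" for n
    using p by (metis f_def prod.collapse)
  have turn: "f (Suc (Suc n)) \<noteq> f n" for n
    using p by (metis f_def)
  have fV: "f n \<in> pverts G" for n
    using arc in_arcsD1 by blast
  \<comment> \<open>Predecessor and successor on the walk are distinct by \<open>turn\<close>, so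
    they exhaust the neighbourhood.\<close>
  have N_Suc: "N (f (Suc n)) = {f n, f (Suc (Suc n))}" for n
    using N_eq[of "f n" "f (Suc n)" "f (Suc (Suc n))"] arc arcs_symmetric turn[of n] fV
    by (auto simp: N_def)

  have "\<not> inj f"
    using finite_subset[of "range f" "pverts G"] fV pair_finite_verts
      range_inj_infinite[of f] by blast
  then obtain i j where "i < j" "f j = f i"
    by (metis linorder_inj_onI' UNIV_I)
  then have ex: "\<exists>m. \<exists>j<m. f m = f j" by blast
  \<comment> \<open>\<open>m\<close> is the first time at which the walk meets an earlier vertex; by
    minimality the first \<open>m\<close> vertices are distinct.\<close>
  define m where "m = (LEAST m. \<exists>j<m. f m = f j)"
  obtain j where j: "j < m" "f m = f j"
    using LeastI_ex[OF ex] unfolding m_def by blast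
  have "f i' \<noteq> f i" if "i' < i" "i < m" for i i'
    using not_less_Least[of i "\<lambda>m. \<exists>j<m. f m = f j"] that unfolding m_def by metis
  then have inj: "inj_on f {..<m}"
    by (intro linorder_inj_onI') simp_all
  have m: "m = Suc (m - 1)" using j by simp
  have no_loop: "f (Suc i) \<noteq> f i" for i
    using no_loops'[OF arc[of i]] by simp
  \<comment> \<open>Were \<open>j\<close> positive, \<open>f (m - 1)\<close> would be a neighbour of
    \<open>f j\<close>, hence \<open>f (j - 1)\<close> or \<open>f (j + 1)\<close>. Distinctness
    leaves only \<open>m = j + 2\<close>, and then the walk would have turned back.\<close>
  have "j = 0"
  proof (rule ccontr)
    assume "j \<noteq> 0"
    then obtain i where i: "j = Suc i" using not0_implies_Suc by blast
    have "f (m - 1) \<in> N (f j)"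
      using arc[of "m - 1"] arcs_symmetric m j(2) by (auto simp: N_def)
    then have "f (m - 1) = f i \<or> f (m - 1) = f (Suc (Suc i))"
      using N_Suc i by auto
    moreover have "f (m - 1) \<noteq> f i"
      using inj_onD[OF inj, of "m - 1" i] i j(1) by auto
    moreover have "m - 1 \<noteq> j"
      using no_loop[of j] j m by metis
    ultimately have "m - 1 = Suc (Suc i)"
      using inj_onD[OF inj, of "m - 1" "Suc (Suc i)"] i j(1) by auto
    then show False using turn[of j] j(2) m i by simp
  qed
  then have f0: "f m = f 0" using j by simp
  have m3: "m \<ge> 3"
  proof (rule ccontr)
    assume "\<not> m \<ge> 3"
    then have "m = 1 \<or> m = 2" using j by auto
    then show False using f0 no_loop[of 0] turn[of 0] by (auto simp: numeral_2_eq_2)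
  qed
  \<comment> \<open>Index \<open>m\<close> may be read as \<open>0\<close>, which matches the
    modular adjacency of \<open>cycle_graph\<close>.\<close>
  have f_mod: "f (Suc i mod m) = f (Suc i)" if "i < m" for i
    using that f0 by (cases "Suc i = m") auto
  \<comment> \<open>\<open>N_Suc\<close> covers positive indices only. At the starting point the
    predecessor is \<open>f (m - 1)\<close>, which differs from \<open>f 1\<close> because
    \<open>m \<ge> 3\<close>.\<close>
  have N0: "N (f 0) = {f 1, f (m - 1)}"
  proof (rule N_eq)
    show "f 1 \<in> N (f 0)" using arc[of 0] by (simp add: N_def)
    show "f (m - 1) \<in> N (f 0)" using arc[of "m - 1"] arcs_symmetric m f0 by (auto simp: N_def)
    show "f 1 \<noteq> f (m - 1)" using inj_onD[OF inj, of 1 "m - 1"] m3 by auto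
  qed (rule fV)
  have N_f: "\<exists>k. v = f k \<and> (i, k) \<in> parcs (cycle_graph m)" if "i < m" "v \<in> N (f i)" for i v
  proof (cases i)
    case 0
    then have "v = f 1 \<or> v = f (m - 1)" using N0 that by auto
    moreover have "(0, 1) \<in> parcs (cycle_graph m)" "(0, m - 1) \<in> parcs (cycle_graph m)"
      using m3 by auto
    ultimately show ?thesis using 0 by blast
  next
    case (Suc k)
    then have "v = f k \<or> v = f (Suc i mod m)" using N_Suc that f_mod by auto
    moreover have "(i, k) \<in> parcs (cycle_graph m)" "(i, Suc i mod m) \<in> parcs (cycle_graph m)"
      using m3 Suc that by auto
    ultimately show ?thesis by blast
  qed
  have "pverts G \<subseteq> f ` {..<m}"
  proof (rule connected_closed_superset[OF assms(1,3), of "f 0"])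
    show "f 0 \<in> f ` {..<m}" using m3 by auto
    fix u v assume "u \<in> f ` {..<m}" "(u, v) \<in> parcs G"
    then show "v \<in> f ` {..<m}" using N_f by (fastforce simp: N_def)
  qed (rule fV)
  then have verts: "f ` {..<m} = pverts G" using fV by auto
  have "(f i, f k) \<in> parcs G" if "(i, k) \<in> parcs (cycle_graph m)" for i k
    using that f_mod[of i] f_mod[of k] arc[of i] arc[of k] arcs_symmetric by auto
  moreover have "(u, v) \<in> map_prod f f ` parcs (cycle_graph m)" if "(u, v) \<in> parcs G" for u v
  proof -
    have "u \<in> f ` {..<m}" using verts in_arcsD1[OF that] by simp
    then obtain i where "i < m" "u = f i" by auto
    then show ?thesis using N_f[of i v] that by (force simp: N_def)
  qed
  ultimately have "map_prod f f ` parcs (cycle_graph m) = parcs G" by auto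
  then have "rename f (cycle_graph m) = G"
    using verts by (simp add: rename_def)
  moreover have "card (pverts G) = m"
    using card_image[OF inj] verts by simp
  moreover have "pair_wf_digraph (cycle_graph m)"
    using m3 by (intro pair_graph_imp_wf pair_graph_cycle_graph) simp
  ultimately show ?thesis
    using graph_iso_rename graph_iso_sym inj by (metis pverts_cycle_graph)
qed

section \<open>Two-regular dominating graphs\<close>

lemma pverts_dominating_graph [simp]:
  "S \<in> pverts (dominating_graph k G) \<longleftrightarrow> dominating_set G S \<and> card S \<le> k"
  by (simp add: dominating_graph_def Let_def)

lemma parcs_dominating_graph:
  "(S, T) \<in> parcs (dominating_graph k G) \<longleftrightarrow>
     S \<in> pverts (dominating_graph k G) \<and> T \<in> pverts (dominating_graph k G) \<and>
     ((\<exists>v. v \<notin> S \<and> T = insert v S) \<or> (\<exists>v \<in> S. T = S - {v}))"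
  by (simp add: dominating_graph_def Let_def)

text \<open>For finite sets, adding one vertex is the same as inclusion with size difference one.
  Sizes then give the bipartition, and explicit sets can be compared by evaluation.\<close>

lemma parcs_dominating_graph_card:
  assumes "finite (pverts G)"
  shows "(S, T) \<in> parcs (dominating_graph k G) \<longleftrightarrow>
     S \<in> pverts (dominating_graph k G) \<and> T \<in> pverts (dominating_graph k G) \<and>
     (S \<subseteq> T \<and> card T = Suc (card S) \<or> T \<subseteq> S \<and> card S = Suc (card T))"
proof -
  have *: "(\<exists>v. v \<notin> S \<and> T = insert v S) \<longleftrightarrow> S \<subseteq> T \<and> card T = Suc (card S)"
    if "finite S" "finite T" for S T :: "'a set"
  proof
    assume *: "S \<subseteq> T \<and> card T = Suc (card S)"
    then have "card (T - S) = 1" using that by (simp add: card_Diff_subset)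
    then obtain v where "T - S = {v}" by (auto simp: card_1_singleton_iff)
    then show "\<exists>v. v \<notin> S \<and> T = insert v S" using * by blast
  qed (use that in auto)
  have **: "(\<exists>v \<in> S. T = S - {v}) \<longleftrightarrow> (\<exists>v. v \<notin> T \<and> S = insert v T)" by blast
  have "finite U" if "U \<in> pverts (dominating_graph k G)" for U
    using that assms finite_subset by (auto simp: dominating_set_def)
  then show ?thesis
    unfolding parcs_dominating_graph ** using *[of S T] *[of T S] by metis
qed

lemma dominating_set_subset: "dominating_set G S \<Longrightarrow> S \<subseteq> pverts G"
  by (simp add: dominating_set_def)

lemma dominating_set_mono:
  "dominating_set G S \<Longrightarrow> S \<subseteq> T \<Longrightarrow> T \<subseteq> pverts G \<Longrightarrow> dominating_set G T"
  unfolding dominating_set_def by blast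

lemma pair_graph_dominating_graph:
  assumes "finite (pverts G)"
  shows "pair_graph (dominating_graph k G)"
proof
  let ?D = "dominating_graph k G"
  show fin: "finite (pverts ?D)"
    by (rule finite_subset[of _ "Pow (pverts G)"]) (use assms in \<open>auto simp: dominating_set_def\<close>)
  show "finite (parcs ?D)"
    by (rule finite_subset[OF _ finite_cartesian_product[OF fin fin]])
      (auto simp: parcs_dominating_graph)
  show "symmetric (with_proj ?D)"
    unfolding symmetric_def sym_def with_proj_simps parcs_dominating_graph by blast
  show "fst e \<noteq> snd e" if "e \<in> parcs ?D" for e
    using that by (cases e) (auto simp: parcs_dominating_graph)
  show "fst e \<in> pverts ?D" "snd e \<in> pverts ?D" if "e \<in> parcs ?D" for e
    using that by (cases e, simp add: parcs_dominating_graph)+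
qed

text \<open>Adding a vertex preserves domination and can only violate the size bound; deleting one
  respects the bound and can only violate domination. The two summands count these two kinds of
  neighbours.\<close>

lemma out_degree_dominating_graph:
  assumes "finite (pverts G)" "dominating_set G S" "card S \<le> k"
  shows "out_degree (with_proj (dominating_graph k G)) S =
    (if card S < k then card (pverts G) - card S else 0) + card {v \<in> S. dominating_set G (S - {v})}"
proof -
  have SG: "S \<subseteq> pverts G" by (rule dominating_set_subset[OF assms(2)])
  then have fin: "finite S" using assms(1) finite_subset by blast
  define A where "A = (if card S < k then pverts G - S else {})"
  define B where "B = {v \<in> S. dominating_set G (S - {v})}"
  have card_del: "card (S - {v}) \<le> k" for v
    using assms(3) card_Diff1_le[of S v] by linarith
  have "{T. (S, T) \<in> parcs (dominating_graph k G)} = (\<lambda>v. insert v S) ` A \<union> (\<lambda>v. S - {v}) ` B"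
    (is "?L = ?R")
  proof (intro set_eqI iffI)
    fix T assume "T \<in> ?L"
    then consider v where "v \<notin> S" "T = insert v S" "dominating_set G T" "card T \<le> k"
      | v where "v \<in> S" "T = S - {v}" "dominating_set G T"
      by (auto simp: parcs_dominating_graph)
    then show "T \<in> ?R"
    proof cases
      case 1
      then have "v \<in> A"
        using fin dominating_set_subset by (fastforce simp: A_def)
      then show ?thesis using 1 by blast
    qed (auto simp: B_def)
  next
    fix T assume "T \<in> ?R"
    then consider v where "v \<in> A" "T = insert v S" | v where "v \<in> B" "T = S - {v}" by blast
    then show "T \<in> ?L"
    proof cases
      case 1
      then have "card S < k" "v \<in> pverts G" "v \<notin> S" by (auto simp: A_def split: if_splits)
      moreover from this have "dominating_set G T"
        using dominating_set_mono[OF assms(2), of T] SG 1 by blast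
      ultimately show ?thesis
        using 1 assms fin by (auto simp: parcs_dominating_graph)
    next
      case 2
      then show ?thesis using assms card_del by (auto simp: parcs_dominating_graph B_def)
    qed
  qed
  moreover have "card ((\<lambda>v. insert v S) ` A \<union> (\<lambda>v. S - {v}) ` B) = card A + card B"
  proof -
    have "inj_on (\<lambda>v. insert v S) A" "inj_on (\<lambda>v. S - {v}) B"
      by (auto simp: inj_on_def A_def B_def split: if_splits)
    moreover have "finite A" "finite B" using assms(1) fin by (auto simp: A_def B_def)
    moreover have "(\<lambda>v. insert v S) ` A \<inter> (\<lambda>v. S - {v}) ` B = {}"
      by (auto simp: B_def)
    ultimately show ?thesis
      by (simp add: card_Un_disjoint card_image)
  qed
  moreover have "card A = (if card S < k then card (pverts G) - card S else 0)"
    using card_Diff_subset[OF fin SG] by (simp add: A_def)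
  ultimately show ?thesis
    by (simp add: out_degree_with_proj B_def)
qed

text \<open>Ore's argument: without isolated vertices, each \<open>v\<close> in a minimal dominating
  set has a neighbour outside the set, for otherwise \<open>v\<close> could be deleted.\<close>

lemma dominating_set_Compl_minimal:
  assumes "pair_graph G" and nbr: "\<And>v. v \<in> pverts G \<Longrightarrow> \<exists>u. (v, u) \<in> parcs G"
    and S: "dominating_set G S" and min: "\<And>v. v \<in> S \<Longrightarrow> \<not> dominating_set G (S - {v})"
  shows "dominating_set G (pverts G - S)"
  unfolding dominating_set_def
proof (intro conjI ballI)
  interpret pair_graph G by fact
  fix v assume "v \<in> pverts G - (pverts G - S)"
  then have v: "v \<in> S" "v \<in> pverts G" by auto
  have SG: "S \<subseteq> pverts G" by (rule dominating_set_subset[OF S])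
  \<comment> \<open>\<open>w\<close> is a vertex that \<open>S - {v}\<close> fails to dominate:
    either \<open>v\<close> itself, all of whose neighbours then lie outside \<open>S\<close>, or a
    vertex outside \<open>S\<close> whose only neighbour in \<open>S\<close> is
    \<open>v\<close>.\<close>
  obtain w where w: "w \<in> pverts G - (S - {v})" "\<And>u. u \<in> S - {v} \<Longrightarrow> (w, u) \<notin> parcs G"
    using min[OF v(1)] SG unfolding dominating_set_def by blast
  show "\<exists>u \<in> pverts G - S. (v, u) \<in> parcs G"
  proof (cases "w = v")
    case True
    then show ?thesis
      using nbr[OF v(2)] w(2) in_arcsD2 no_loops' by (metis Diff_iff singletonD)
  next
    case False
    then have "w \<in> pverts G - S" using w(1) by blast
    then obtain u where "u \<in> S" "(w, u) \<in> parcs G"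
      using S unfolding dominating_set_def by blast
    then have "(w, v) \<in> parcs G" using w(2) by blast
    then show ?thesis using \<open>w \<in> pverts G - S\<close> arcs_symmetric by blast
  qed
qed simp

section \<open>The order of a two-regular dominating graph\<close>

lemma regular_2_dominating_graph_card:
  assumes "pair_graph G" "connected (with_proj G)"
    and ne: "pverts (dominating_graph k G) \<noteq> {}" and reg: "regular 2 (dominating_graph k G)"
  shows "card (pverts (dominating_graph k G)) \<in> {6, 8}"
proof -
  interpret pair_graph G by fact
  define n where "n = card (pverts G)"
  have fin: "finite (pverts G)" by (rule pair_finite_verts)
  have deg: "(if card T < k then n - card T else 0) + card {v \<in> T. dominating_set G (T - {v})} = 2"
    if "dominating_set G T" "card T \<le> k" for T
  proof -
    have "out_degree (with_proj (dominating_graph k G)) T = 2"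
      using reg that by (simp add: regular_def)
    then show ?thesis unfolding out_degree_dominating_graph[OF fin that] n_def .
  qed
  obtain T\<^sub>0 where "T\<^sub>0 \<in> pverts (dominating_graph k G)" using ne by blast
  \<comment> \<open>A dominating set of minimum size; \<open>T\<^sub>0\<close> ensures that the
    minimum is attained.\<close>
  define S where "S = arg_min card (\<lambda>T. T \<in> pverts (dominating_graph k G))"
  have arg_min: "S \<in> pverts (dominating_graph k G)"
    "\<forall>T. T \<in> pverts (dominating_graph k G) \<longrightarrow> card S \<le> card T"
    using arg_min_nat_lemma[of "\<lambda>T. T \<in> pverts (dominating_graph k G)" T\<^sub>0 card]
      \<open>T\<^sub>0 \<in> _\<close> unfolding S_def by blast+
  then have S: "dominating_set G S" "card S \<le> k" by simp_all
  have least: "card S \<le> card T" if "dominating_set G T" "card T \<le> k" for T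
    using arg_min(2) that by simp
  have finS: "finite S" by (rule finite_subset[OF dominating_set_subset[OF S(1)] fin])
  have min: "\<not> dominating_set G (S - {v})" if "v \<in> S" for v
    using least[of "S - {v}"] card_Diff1_less[OF finS that] S(2) by force
  have no_del: "{v \<in> S. dominating_set G (S - {v})} = {}" using min by blast
  \<comment> \<open>No deletion from \<open>S\<close> dominates, so its degree 2 comes from
    additions alone; hence \<open>card S < k\<close> and \<open>n - card S = 2\<close>.\<close>
  have cardS: "card S < k" "card S + 2 = n"
    using deg[OF S] unfolding no_del by (auto split: if_splits)
  have "pverts G \<noteq> {}" using assms(2) by (simp add: connected_conv)
  then have "S \<noteq> {}" using S(1) by (auto simp: dominating_set_def)
  then have "card S > 0" using finS by (simp add: card_gt_0_iff)
  then have n3: "n \<ge> 3" using cardS(2) by linarith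
  have nbr: "\<exists>u. (v, u) \<in> parcs G" if "v \<in> pverts G" for v
    using connected_has_neighbour[OF assms(1,2) _ that] n3 n_def by auto
  have dom_del: "dominating_set G (pverts G - {v})" if "v \<in> pverts G" for v
    using nbr[OF that] in_arcsD2 no_loops' unfolding dominating_set_def by fastforce
  \<comment> \<open>If \<open>n \<le> k\<close>, the full vertex set would belong to the dominating
    graph, and its \<open>n \<ge> 3\<close> deletions, all dominating, would give it a degree above
    2.\<close>
  have "k < n"
  proof (rule ccontr)
    assume "\<not> k < n"
    moreover have "{v \<in> pverts G. dominating_set G (pverts G - {v})} = pverts G"
      using dom_del by blast
    moreover have "dominating_set G (pverts G)" by (simp add: dominating_set_def)
    ultimately show False using deg[of "pverts G"] n3 by (simp flip: n_def split: if_splits)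
  qed
  then have k: "k = n - 1" using cardS by linarith
  have "card (pverts G - S) = 2"
    using card_Diff_subset[OF finS dominating_set_subset[OF S(1)]] cardS n_def by simp
  \<comment> \<open>The complement of \<open>S\<close> dominates and its size 2 is at most
    \<open>k = n - 1\<close>, so the minimality of \<open>S\<close> applies to it.\<close>
  then have "card S \<le> 2"
    using least[OF dominating_set_Compl_minimal[OF assms(1) nbr S(1) min]] k n3 by simp
  then have n: "n = 3 \<or> n = 4" using cardS n3 by linarith

  \<comment> \<open>The two levels that occur: sizes run from the minimum \<open>n - 2\<close> up to
    \<open>k = n - 1\<close>.\<close>
  define A where "A = {T. T \<subseteq> pverts G \<and> card T = n - 1}"
  define B where "B = {T. dominating_set G T \<and> card T = n - 2}"
  \<comment> \<open>No vertex is isolated, so the one vertex missing from \<open>T\<close> has a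
    neighbour in \<open>T\<close>.\<close>
  have domA: "dominating_set G T" if "T \<in> A" for T
  proof -
    have T: "T \<subseteq> pverts G" "card T = n - 1" using that by (auto simp: A_def)
    then have "card (pverts G - T) = 1"
      using card_Diff_subset[of T "pverts G"] finite_subset[OF _ fin] n3 n_def by simp
    then obtain v where "pverts G - T = {v}" by (auto simp: card_1_singleton_iff)
    then have "T = pverts G - {v}" "v \<in> pverts G" using T(1) by auto
    then show ?thesis using dom_del by simp
  qed
  have split: "pverts (dominating_graph k G) = A \<union> B"
  proof (intro set_eqI iffI)
    fix T assume "T \<in> pverts (dominating_graph k G)"
    then have "dominating_set G T" "card T \<le> n - 1" "n - 2 \<le> card T"
      using least[of T] cardS k by auto
    then show "T \<in> A \<union> B"
      using dominating_set_subset unfolding A_def B_def by fastforce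
  next
    fix T assume "T \<in> A \<union> B"
    then show "T \<in> pverts (dominating_graph k G)"
      using domA k by (auto simp: A_def B_def)
  qed
  have AB: "A \<inter> B = {}" using n3 by (auto simp: A_def B_def)
  \<comment> \<open>Adjacent sets have different sizes and only two sizes occur, so every edge joins
    the two levels.\<close>
  have cross: "T \<in> A \<longleftrightarrow> U \<in> B" if "(T, U) \<in> parcs (dominating_graph k G)" for T U
  proof -
    have TU: "T \<in> A \<union> B" "U \<in> A \<union> B"
      and "card T \<noteq> card U"
      using that split unfolding parcs_dominating_graph_card[OF fin] by auto
    moreover have "card X = n - 1 \<longleftrightarrow> X \<in> A" "card X = n - 2 \<longleftrightarrow> X \<in> B" if "X \<in> A \<union> B" for X
      using that n3 by (auto simp: A_def B_def)
    ultimately show ?thesis using TU AB by (metis IntI Un_iff empty_iff)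
  qed
  have "card A = card B"
    by (rule regular_bipartite_card_eq[OF pair_graph_dominating_graph[OF fin] reg _ split cross]) simp
  \<comment> \<open>\<open>A\<close> consists of all subsets that omit one vertex.\<close>
  moreover have "card A = n"
    unfolding A_def using n_subsets[OF fin, of "n - 1"] n3 unfolding n_def[symmetric]
    by (cases n) simp_all
  moreover have "finite A" "finite B"
    by (rule finite_subset[of _ "Pow (pverts G)"]; use fin dominating_set_subset in \<open>auto simp: A_def B_def\<close>)+
  ultimately have "card (pverts (dominating_graph k G)) = 2 * n"
    using split AB by (simp add: card_Un_disjoint)
  then show ?thesis using n by auto
qed

section \<open>The two cycles as dominating graphs\<close>

definition path_graph_4 :: "nat pair_pre_digraph" where
  "path_graph_4 = \<lparr> pverts = {..<4}, parcs = {(i, j). i < 4 \<and> j < 4 \<and> (j = Suc i \<or> i = Suc j)} \<rparr>"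

lemma pair_graph_path_graph_4: "pair_graph path_graph_4"
proof
  show "finite (parcs path_graph_4)"
    by (rule finite_subset[of _ "{..<4} \<times> {..<4}"]) (auto simp: path_graph_4_def)
qed (auto simp: path_graph_4_def symmetric_def sym_def)

lemma connected_path_graph_4: "connected (with_proj path_graph_4)"
proof (rule connected_rootI[OF pair_graph_path_graph_4, of 0])
  fix i assume "i \<in> pverts path_graph_4"
  then have "i < 4" by (simp add: path_graph_4_def)
  then show "(0, i) \<in> (parcs path_graph_4)\<^sup>*"
  proof (induction i)
    case (Suc i)
    then have "(i, Suc i) \<in> parcs path_graph_4" by (simp add: path_graph_4_def)
    then show ?case using Suc by (meson Suc_lessD rtrancl.rtrancl_into_rtrancl)
  qed simp
qed (simp add: path_graph_4_def)

text \<open>Reduces the claim to a cyclic listing \<open>f\<close> of the dominating sets of size at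
  most \<open>k\<close>; what remains concerns inclusions and sizes of explicit finite sets.\<close>

lemma cycle_graph_iso_dominating_graphI:
  assumes "finite (pverts G)" "m \<ge> 2" "inj_on f {..<m}"
    and V: "pverts (dominating_graph k G) = f ` {..<m}"
    and arcs: "\<And>i j. i < m \<Longrightarrow> j < m \<Longrightarrow> (i, j) \<in> parcs (cycle_graph m) \<longleftrightarrow>
      f i \<subseteq> f j \<and> card (f j) = Suc (card (f i)) \<or> f j \<subseteq> f i \<and> card (f i) = Suc (card (f j))"
  shows "cycle_graph m \<cong>\<^sub>g dominating_graph k G"
proof (rule graph_isoI)
  show "pair_wf_digraph (cycle_graph m)" "pair_wf_digraph (dominating_graph k G)"
    using assms(1,2)
    by (auto intro!: pair_graph_imp_wf pair_graph_cycle_graph pair_graph_dominating_graph)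
  show "bij_betw f (pverts (cycle_graph m)) (pverts (dominating_graph k G))"
    using assms(3) by (simp add: bij_betw_def V)
next
  fix i j assume "i \<in> pverts (cycle_graph m)" "j \<in> pverts (cycle_graph m)"
  then have ij: "i < m" "j < m" by simp_all
  then have "f i \<in> pverts (dominating_graph k G)" "f j \<in> pverts (dominating_graph k G)"
    unfolding V by blast+
  then show "(i, j) \<in> parcs (cycle_graph m) \<longleftrightarrow> (f i, f j) \<in> parcs (dominating_graph k G)"
    using arcs[OF ij] parcs_dominating_graph_card[OF assms(1)] by blast
qed

text \<open>\<open>cycle_graph 3\<close> is \<open>K_3\<close>, where every nonempty set dominates;
  the three singletons and the three pairs alternate around the hexagon.\<close>

lemma cycle_graph_6_iso_dominating_graph:
  "cycle_graph 6 \<cong>\<^sub>g dominating_graph 2 (cycle_graph 3)"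
proof -
  define f :: "nat \<Rightarrow> nat set" where "f i = [{0}, {0, 1}, {1}, {1, 2}, {2}, {0, 2}] ! i" for i
  have f: "f 0 = {0}" "f 1 = {0, 1}" "f 2 = {1}" "f 3 = {1, 2}" "f 4 = {2}" "f 5 = {0, 2}"
    by (simp_all add: f_def)
  have six: "{..<6::nat} = {0, 1, 2, 3, 4, 5}" and three: "{..<3::nat} = {0, 1, 2}" by auto
  show ?thesis
  proof (rule cycle_graph_iso_dominating_graphI)
    show "inj_on f {..<6}" by (simp add: six f set_eq_subset del: One_nat_def)
    show "pverts (dominating_graph 2 (cycle_graph 3)) = f ` {..<6}"
    proof (intro set_eqI iffI)
      fix S assume S: "S \<in> pverts (dominating_graph 2 (cycle_graph 3))"
      then have "S \<subseteq> {0, 1, 2}" by (simp add: dominating_set_def three)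
      \<comment> \<open>The power set is enumerated: each subset is listed by \<open>f\<close>,
        fails to dominate, or is too large.\<close>
      then have "S \<in> Pow {0, 1, 2}" by (rule PowI)
      then show "S \<in> f ` {..<6}"
        using S unfolding Pow_insert Pow_empty image_insert image_empty Un_insert_left Un_insert_right
          Un_empty_left Un_empty_right insert_iff empty_iff six f
        by - (elim disjE FalseE; hypsubst; auto simp: dominating_set_def three insert_Diff_if)
    next
      fix S assume "S \<in> f ` {..<6}"
      then show "S \<in> pverts (dominating_graph 2 (cycle_graph 3))"
        unfolding image_insert image_empty insert_iff empty_iff six f
        by - (elim disjE FalseE; hypsubst; simp add: dominating_set_def three insert_Diff_if)
    qed
    fix i j :: nat assume "i < 6" "j < 6"
    then have "i \<in> {0, 1, 2, 3, 4, 5}" "j \<in> {0, 1, 2, 3, 4, 5}" unfolding six[symmetric] by simp_all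
    then show "(i, j) \<in> parcs (cycle_graph 6) \<longleftrightarrow>
      f i \<subseteq> f j \<and> card (f j) = Suc (card (f i)) \<or> f j \<subseteq> f i \<and> card (f i) = Suc (card (f j))"
      unfolding insert_iff empty_iff parcs_cycle_graph by - (elim disjE FalseE; simp add: f del: One_nat_def)
  qed simp_all
qed

text \<open>In the path 0-1-2-3 no single vertex dominates, the dominating pairs are all but
  \<open>{0, 1}\<close> and \<open>{2, 3}\<close>, and all four triples dominate. Pairs and triples
  alternate around the cycle.\<close>

lemma cycle_graph_8_iso_dominating_graph:
  "cycle_graph 8 \<cong>\<^sub>g dominating_graph 3 path_graph_4"
proof -
  define f :: "nat \<Rightarrow> nat set" where
    "f i = [{0, 2}, {0, 1, 2}, {1, 2}, {1, 2, 3}, {1, 3}, {0, 1, 3}, {0, 3}, {0, 2, 3}] ! i" for i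
  have f: "f 0 = {0, 2}" "f 1 = {0, 1, 2}" "f 2 = {1, 2}" "f 3 = {1, 2, 3}"
    "f 4 = {1, 3}" "f 5 = {0, 1, 3}" "f 6 = {0, 3}" "f 7 = {0, 2, 3}"
    by (simp_all add: f_def)
  have eight: "{..<8::nat} = {0, 1, 2, 3, 4, 5, 6, 7}" and four: "{..<4::nat} = {0, 1, 2, 3}" by auto
  show ?thesis
  proof (rule cycle_graph_iso_dominating_graphI)
    show "inj_on f {..<8}" by (simp add: eight f set_eq_subset del: One_nat_def)
    show "pverts (dominating_graph 3 path_graph_4) = f ` {..<8}"
    proof (intro set_eqI iffI)
      fix S assume S: "S \<in> pverts (dominating_graph 3 path_graph_4)"
      then have "S \<subseteq> {0, 1, 2, 3}" by (simp add: dominating_set_def path_graph_4_def four)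
      then have "S \<in> Pow {0, 1, 2, 3}" by (rule PowI)
      then show "S \<in> f ` {..<8}"
        using S unfolding Pow_insert Pow_empty image_insert image_empty Un_insert_left Un_insert_right
          Un_empty_left Un_empty_right insert_iff empty_iff eight f
        by - (elim disjE FalseE; hypsubst; auto simp: dominating_set_def path_graph_4_def four insert_Diff_if)
    next
      fix S assume "S \<in> f ` {..<8}"
      then show "S \<in> pverts (dominating_graph 3 path_graph_4)"
        unfolding image_insert image_empty insert_iff empty_iff eight f
        by - (elim disjE FalseE; hypsubst; simp add: dominating_set_def path_graph_4_def four insert_Diff_if)
    qed
    fix i j :: nat assume "i < 8" "j < 8"
    then have "i \<in> {0, 1, 2, 3, 4, 5, 6, 7}" "j \<in> {0, 1, 2, 3, 4, 5, 6, 7}"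
      unfolding eight[symmetric] by simp_all
    then show "(i, j) \<in> parcs (cycle_graph 8) \<longleftrightarrow>
      f i \<subseteq> f j \<and> card (f j) = Suc (card (f i)) \<or> f j \<subseteq> f i \<and> card (f i) = Suc (card (f j))"
      unfolding insert_iff empty_iff parcs_cycle_graph by - (elim disjE FalseE; simp add: f del: One_nat_def)
  qed (simp_all add: path_graph_4_def)
qed

section \<open>Classification of the two-regular dominating graphs\<close>

theorem corollary4p2:
  shows "(D2 :: 'a pair_pre_digraph set) =
    {H. pair_graph H \<and> (H \<cong>\<^sub>g cycle_graph 6 \<or> H \<cong>\<^sub>g cycle_graph 8)}"
proof (intro set_eqI iffI)
  fix H :: "'a pair_pre_digraph" assume "H \<in> D2"
  then obtain G :: "nat pair_pre_digraph" and k where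
    H: "pair_graph H" "regular 2 H" "connected (with_proj H)" and
    G: "pair_graph G" "connected (with_proj G)" and iso: "H \<cong>\<^sub>g dominating_graph k G"
    unfolding D2_def by blast
  have "pverts H \<noteq> {}" using H(3) by (simp add: connected_conv)
  then have "pverts (dominating_graph k G) \<noteq> {}"
    using graph_iso_pverts[OF iso] by (metis bij_betw_empty1 bij_betw_empty2)
  then have "card (pverts H) \<in> {6, 8}"
    using regular_2_dominating_graph_card[OF G] graph_iso_regular[OF _ iso H(2)] graph_iso_card[OF iso]
      pair_graph_imp_wf[OF H(1)] by simp
  \<comment> \<open>Being connected and 2-regular, \<open>H\<close> is a cycle on its own number of
    vertices, which is 6 or 8.\<close>
  then show "H \<in> {H. pair_graph H \<and> (H \<cong>\<^sub>g cycle_graph 6 \<or> H \<cong>\<^sub>g cycle_graph 8)}"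
    using connected_regular_2_iso_cycle_graph[OF H] H(1) by auto
next
  fix H :: "'a pair_pre_digraph"
  assume "H \<in> {H. pair_graph H \<and> (H \<cong>\<^sub>g cycle_graph 6 \<or> H \<cong>\<^sub>g cycle_graph 8)}"
  then have H: "pair_graph H" and iso: "H \<cong>\<^sub>g cycle_graph 6 \<or> H \<cong>\<^sub>g cycle_graph 8" by auto
  \<comment> \<open>Regularity and connectedness of \<open>H\<close> are carried over from the
    cycle, so only a witness pair \<open>G\<close>, \<open>k\<close> has to be supplied.\<close>
  have *: "H \<in> D2"
    if "H \<cong>\<^sub>g cycle_graph m" "m \<ge> 3" "cycle_graph m \<cong>\<^sub>g dominating_graph k G" "k > 0"
      "pair_graph G" "connected (with_proj G)" for m k and G :: "nat pair_pre_digraph"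
  proof (rule D2_I[OF H _ _ that(5,6,4)])
    have wf: "pair_wf_digraph (cycle_graph m)"
      using that(2) by (intro pair_graph_imp_wf pair_graph_cycle_graph) simp
    have "cycle_graph m \<cong>\<^sub>g H"
      by (rule graph_iso_sym[OF pair_graph_imp_wf[OF H] that(1)])
    then show "regular 2 H" "connected (with_proj H)"
      using graph_iso_regular[OF wf _ regular_cycle_graph[OF that(2)]]
        graph_iso_connected[OF wf _ connected_cycle_graph] that(2) by simp_all
    show "H \<cong>\<^sub>g dominating_graph k G" by (rule graph_iso_trans[OF that(1,3)])
  qed
  \<comment> \<open>The witnesses are \<open>K_3\<close> with \<open>k = 2\<close> and
    \<open>P_4\<close> with \<open>k = 3\<close>.\<close>
  show "H \<in> D2"
    using iso *[OF _ _ cycle_graph_6_iso_dominating_graph] *[OF _ _ cycle_graph_8_iso_dominating_graph]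
      pair_graph_cycle_graph connected_cycle_graph pair_graph_path_graph_4 connected_path_graph_4
    by auto
qed

end
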